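(* Let $\boldsymbol\lambda\in\mathbb R_+^2$. Let $\mathcal U^*$ be the set of all $\mathbf u$ for which there exist $\boldsymbol\theta,\mathbf f,\mathbf p$ such that $(\boldsymbol\theta,\mathbf f,\mathbf p,\mathbf u)$ is an optimal solution to the original problem (Battery), and let $\mathcal P^*$ be the set of all $\mathbf p$ for which there exist $\boldsymbol\theta,\mathbf f,\mathbf u$ such that $(\boldsymbol\theta,\mathbf f,\mathbf p,\mathbf u)$ is an optimal solution to (Battery). Let $z^{\mathrm{ori}}(\mathcal U^* )$ be the minimum of $c(\mathbf p)$ over all $(\boldsymbol\theta,\mathbf f,\mathbf p,\mathbf u)$ satisfying the operational constraints with $\mathbf u\in\{0,1\}^{T\times N}\setminus\mathcal U^*$ (the second-best optimal value), and let $\delta=|z^{\mathrm{ori}}(\mathcal U^* )-z^{\mathrm{ori}}|>0$. Suppose $(\hat{\boldsymbol\theta},\hat{\mathbf f},\hat{\mathbf p},\hat{\mathbf u})$ is an optimal solution to the regularized problem (Reg-Battery) with parameter $\boldsymbol\lambda$. If $\boldsymbol\lambda^\top g(\mathbf p^* )<\delta$ for some $\mathbf p^*\in\mathcal P^*$, then $\hat{\mathbf u}\in\mathcal U^*$.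
   Context: Data. $\mathcal N$ is a finite set of buses, $\mathcal L\subseteq\mathcal N\times\mathcal N$ a finite set of transmission lines, $\mathcal N_b\subseteq\mathcal N$ the set of buses carrying a battery, $\mathcal T=\{1,\dots,T\}$ the time periods, $N=|\mathcal N|$, $N_b=|\mathcal N_b|$. For $i\in\mathcal N$, $\delta_i^+=\{j:(i,j)\in\mathcal L\}$ and $\delta_i^-=\{j:(j,i)\in\mathcal L\}$. Real parameters: $0\le G_i^{\min}\le G_i^{\max}$ ($i\in\mathcal N$), $F_{ij}\ge0$ and $B_{ij}$ ($(i,j)\in\mathcal L$), demands $D_{t,i}$, $0\le E^{\min}\le E^{\max}$, $0\le E_c^{\min}\le E_c^{\max}$, $0\le E_d^{\min}\le E_d^{\max}$, initial state-of-charge $E_0$, and efficiencies $\eta_c,\eta_d\in(0,1]$. Variables (indexed by $t\in\mathcal T$): phase angles $\theta_{t,i}$, flows $f_{t,ij}$, $\mathbf p=(\mathbf p^g,\mathbf p^s,\mathbf p^c,\mathbf p^d,\mathbf p^{ls},\mathbf p^{ex})$ (generation, state-of-charge, charging, discharging, load shedding, excess power; $p^s$ also has components $p^s_{0,i}$), and $u_{t,i}$. Operational constraints: - $G_i^{\min}\le p^g_{t,i}\le G_i^{\max}$ for all $t\in\mathcal T,i\in\mathcal N$; - $-F_{ij}\le f_{t,ij}\le F_{ij}$ and $f_{t,ij}=B_{ij}(\theta_{t,i}-\theta_{t,j})$ for all $t\in\mathcal T,(i,j)\in\mathcal L$; - for $t\in\mathcal T,i\in\mathcal N_b$: $E_c^{\min}u_{t,i}\le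 p^c_{t,i}\le E_c^{\max}u_{t,i}$; $E_d^{\min}(1-u_{t,i})\le p^d_{t,i}\le E_d^{\max}(1-u_{t,i})$; $p^s_{t,i}=p^s_{t-1,i}+\eta_c p^c_{t,i}-\frac1{\eta_d}p^d_{t,i}$; $p^s_{0,i}=E_0$; $E^{\min}\le p^s_{t,i}\le E^{\max}$; - for $t\in\mathcal T,i\in\mathcal N\setminus\mathcal N_b$: $p^s_{t,i}=p^s_{0,i}=p^c_{t,i}=p^d_{t,i}=u_{t,i}=0$; - $p^{ls}_{t,i}\ge0$, $p^{ex}_{t,i}\ge0$ for all $t\in\mathcal T,i\in\mathcal N$; - $\sum_{j\in\delta_i^+}f_{t,ij}-\sum_{j\in\delta_i^-}f_{t,ji}=p^g_{t,i}-D_{t,i}-p^c_{t,i}+p^d_{t,i}+p^{ls}_{t,i}-p^{ex}_{t,i}$ for all $t\in\mathcal T,i\in\mathcal N$. Objective: $c(\mathbf p)=c^g(\mathbf p^g)+\sum_{t\in\mathcal T}\sum_{i\in\mathcal N}(p^{ls}_{t,i}+p^{ex}_{t,i})$, where $c^g$ is a real-valued generator cost function (usually linear or convex quadratic), and $g(\mathbf p)=\left(\sum_{t\in\mathcal T}\sum_{i\in\mathcal N}p^c_{t,i},\ \sum_{t\in\mathcal T}\sum_{i\in\mathcal N}p^d_{t,i}\right)^\top$. The original problem (Battery) is to minimize $c(\mathbf p)$ over all $(\boldsymbol\theta,\mathbf f,\mathbf p,\mathbf u)$ satisfying the operational constraints and $\mathbf u\in\{0,1\}^{T\times N}$; its optimal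 value is $z^{\mathrm{ori}}$. The regularized problem (Reg-Battery) with parameter $\boldsymbol\lambda\in\mathbb R_+^2$ is to minimize $c(\mathbf p)+\boldsymbol\lambda^\top g(\mathbf p)$ over the same set. (An optimal value over an empty feasible set is $+\infty$.) *)

theory Defs
  imports "HOL-Analysis.Analysis"
begin

record 'b battery_system =
  buses :: "'b set"
  lines :: "('b \<times> 'b) set"
  battery_buses :: "'b set"
  horizon :: nat
  Gmin :: "'b \<Rightarrow> real"
  Gmax :: "'b \<Rightarrow> real"
  Fmax :: "'b \<times> 'b \<Rightarrow> real"
  Bsus :: "'b \<times> 'b \<Rightarrow> real"
  demand :: "nat \<times> 'b \<Rightarrow> real"
  Emin :: real
  Emax :: real
  Ecmin :: real
  Ecmax :: real
  Edmin :: real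
  Edmax :: real
  Einit :: real
  eta_c :: real
  eta_d :: real
  gen_cost :: "(nat \<times> 'b \<Rightarrow> real) \<Rightarrow> real"

definition periods :: "'b battery_system \<Rightarrow> nat set" where
  "periods S = {1..horizon S}"

definition valid_system :: "'b battery_system \<Rightarrow> bool" where
  "valid_system S \<longleftrightarrow>
     finite (buses S) \<and>
     lines S \<subseteq> buses S \<times> buses S \<and>
     battery_buses S \<subseteq> buses S \<and>
     (\<forall>i\<in>buses S. 0 \<le> Gmin S i \<and> Gmin S i \<le> Gmax S i) \<and>
     (\<forall>l\<in>lines S. 0 \<le> Fmax S l) \<and>
     0 \<le> Emin S \<and> Emin S \<le> Emax S \<and>
     0 \<le> Ecmin S \<and> Ecmin S \<le> Ecmax S \<and>
     0 \<le> Edmin S \<and> Edmin S \<le> Edmax S \<and>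
     0 < eta_c S \<and> eta_c S \<le> 1 \<and>
     0 < eta_d S \<and> eta_d S \<le> 1"

text \<open>Generation, state of charge, charging, discharging, load shedding, excess power.\<close>

record 'b powers =
  pg :: "nat \<times> 'b \<Rightarrow> real"
  ps :: "nat \<times> 'b \<Rightarrow> real"
  pc :: "nat \<times> 'b \<Rightarrow> real"
  pd :: "nat \<times> 'b \<Rightarrow> real"
  pls :: "nat \<times> 'b \<Rightarrow> real"
  pex :: "nat \<times> 'b \<Rightarrow> real"

text \<open>A decision is a tuple of phase angles, line flows, powers and battery statuses.\<close>

type_synonym 'b decision =
  "(nat \<times> 'b \<Rightarrow> real) \<times> (nat \<times> 'b \<times> 'b \<Rightarrow> real) \<times> 'b powers \<times> (nat \<times> 'b \<Rightarrow> real)"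

text \<open>
  A real vector with index set \<open>I\<close> is a function in \<^term>\<open>extensional I\<close>. Fixing the values
  outside \<open>I\<close> identifies functions with vectors, so that \<^const>\<open>gen_cost\<close> is evaluated on
  genuine vectors only and cannot depend on spurious components.
\<close>

definition decision_space :: "'b battery_system \<Rightarrow> 'b decision set" where
  "decision_space S = {(\<theta>, f, p, u).
     \<theta> \<in> extensional (periods S \<times> buses S) \<and>
     f \<in> extensional (periods S \<times> lines S) \<and>
     pg p \<in> extensional (periods S \<times> buses S) \<and>
     ps p \<in> extensional (insert 0 (periods S) \<times> buses S) \<and>
     pc p \<in> extensional (periods S \<times> buses S) \<and>
     pd p \<in> extensional (periods S \<times> buses S) \<and>
     pls p \<in> extensional (periods S \<times> buses S) \<and>
     pex p \<in> extensional (periods S \<times> buses S) \<and>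
     u \<in> extensional (periods S \<times> buses S)}"

definition operational_constraints :: "'b battery_system \<Rightarrow> 'b decision \<Rightarrow> bool" where
  "operational_constraints S = (\<lambda>(\<theta>, f, p, u).
     (\<forall>t\<in>periods S. \<forall>i\<in>buses S. Gmin S i \<le> pg p (t, i) \<and> pg p (t, i) \<le> Gmax S i) \<and>
     (\<forall>t\<in>periods S. \<forall>(i, j)\<in>lines S.
        - Fmax S (i, j) \<le> f (t, i, j) \<and> f (t, i, j) \<le> Fmax S (i, j) \<and>
        f (t, i, j) = Bsus S (i, j) * (\<theta> (t, i) - \<theta> (t, j))) \<and>
     (\<forall>t\<in>periods S. \<forall>i\<in>battery_buses S.
        Ecmin S * u (t, i) \<le> pc p (t, i) \<and> pc p (t, i) \<le> Ecmax S * u (t, i) \<and>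
        Edmin S * (1 - u (t, i)) \<le> pd p (t, i) \<and> pd p (t, i) \<le> Edmax S * (1 - u (t, i)) \<and>
        ps p (t, i) = ps p (t - 1, i) + eta_c S * pc p (t, i) - 1 / eta_d S * pd p (t, i) \<and>
        ps p (0, i) = Einit S \<and>
        Emin S \<le> ps p (t, i) \<and> ps p (t, i) \<le> Emax S) \<and>
     (\<forall>t\<in>periods S. \<forall>i\<in>buses S - battery_buses S.
        ps p (t, i) = 0 \<and> ps p (0, i) = 0 \<and> pc p (t, i) = 0 \<and> pd p (t, i) = 0 \<and> u (t, i) = 0) \<and>
     (\<forall>t\<in>periods S. \<forall>i\<in>buses S. 0 \<le> pls p (t, i) \<and> 0 \<le> pex p (t, i)) \<and>
     (\<forall>t\<in>periods S. \<forall>i\<in>buses S.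
        (\<Sum>j | (i, j) \<in> lines S. f (t, i, j)) - (\<Sum>j | (j, i) \<in> lines S. f (t, j, i)) =
        pg p (t, i) - demand S (t, i) - pc p (t, i) + pd p (t, i) + pls p (t, i) - pex p (t, i)))"

definition binary_statuses :: "'b battery_system \<Rightarrow> (nat \<times> 'b \<Rightarrow> real) set" where
  "binary_statuses S = periods S \<times> buses S \<rightarrow>\<^sub>E {0, 1}"

definition feasible_set ::
    "'b battery_system \<Rightarrow> (nat \<times> 'b \<Rightarrow> real) set \<Rightarrow> 'b decision set" where
  "feasible_set S W =
     {(\<theta>, f, p, u) \<in> decision_space S. operational_constraints S (\<theta>, f, p, u) \<and> u \<in> W}"

definition total_cost :: "'b battery_system \<Rightarrow> 'b powers \<Rightarrow> real" where
  "total_cost S p =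
     gen_cost S (pg p) + (\<Sum>t\<in>periods S. \<Sum>i\<in>buses S. pls p (t, i) + pex p (t, i))"

definition battery_usage :: "'b battery_system \<Rightarrow> 'b powers \<Rightarrow> real ^ 2" where
  "battery_usage S p =
     vector [\<Sum>t\<in>periods S. \<Sum>i\<in>buses S. pc p (t, i),
             \<Sum>t\<in>periods S. \<Sum>i\<in>buses S. pd p (t, i)]"

definition battery_optimal :: "'b battery_system \<Rightarrow> 'b decision \<Rightarrow> bool" where
  "battery_optimal S =
     is_arg_min (\<lambda>(\<theta>, f, p, u). total_cost S p) (\<lambda>x. x \<in> feasible_set S (binary_statuses S))"

definition reg_battery_optimal :: "'b battery_system \<Rightarrow> real ^ 2 \<Rightarrow> 'b decision \<Rightarrow> bool" where
  "reg_battery_optimal S l =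
     is_arg_min (\<lambda>(\<theta>, f, p, u). total_cost S p + l \<bullet> battery_usage S p)
       (\<lambda>x. x \<in> feasible_set S (binary_statuses S))"

definition optimal_statuses :: "'b battery_system \<Rightarrow> (nat \<times> 'b \<Rightarrow> real) set" where
  "optimal_statuses S = {u. \<exists>\<theta> f p. battery_optimal S (\<theta>, f, p, u)}"

definition optimal_powers :: "'b battery_system \<Rightarrow> 'b powers set" where
  "optimal_powers S = {p. \<exists>\<theta> f u. battery_optimal S (\<theta>, f, p, u)}"

text \<open>
  Optimal values are infima in the extended reals, hence \<open>\<infinity>\<close> for an empty feasible set.
\<close>

definition optimal_value ::
    "'b battery_system \<Rightarrow> (nat \<times> 'b \<Rightarrow> real) set \<Rightarrow> ereal" where
  "optimal_value S W = (INF (\<theta>, f, p, u)\<in>feasible_set S W. ereal (total_cost S p))"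

definition z_ori :: "'b battery_system \<Rightarrow> ereal" where
  "z_ori S = optimal_value S (binary_statuses S)"

definition z_second :: "'b battery_system \<Rightarrow> ereal" where
  "z_second S = optimal_value S (binary_statuses S - optimal_statuses S)"

definition optimality_gap :: "'b battery_system \<Rightarrow> ereal" where
  "optimality_gap S = \<bar>z_second S - z_ori S\<bar>"

end

theory Submission
  imports Defs
begin

text \<open>
  Let \<open>p\<close> be optimal for (Battery). Battery usage is nonnegative on feasible points, so optimality
  of \<open>ph\<close> for (Reg-Battery) gives
  \<open>c(ph) \<le> c(ph) + \<lambda>\<cdot>g(ph) \<le> c(p) + \<lambda>\<cdot>g(p) < z_ori + \<delta>\<close>.
  If \<open>uh\<close> were not an optimal status vector, \<open>ph\<close> would compete in the second-best problem, whence
  \<open>z_second \<le> c(ph) < z_ori + \<delta> = z_second\<close>.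
\<close>

text \<open>At battery buses a binary status makes the lower bounds
  \<open>Ecmin S * u (t, i)\<close> and \<open>Edmin S * (1 - u (t, i))\<close> nonnegative; at all
  other buses charging and discharging vanish.\<close>

lemma battery_usage_nonneg:
  assumes "valid_system S" and "(\<theta>, f, p, u) \<in> feasible_set S (binary_statuses S)"
  shows "0 \<le> battery_usage S p $ k"
proof -
  have oc: "operational_constraints S (\<theta>, f, p, u)" and u: "u \<in> binary_statuses S"
    using assms(2) by (auto simp: feasible_set_def)
  have "0 \<le> pc p (t, i) \<and> 0 \<le> pd p (t, i)" if t: "t \<in> periods S" and i: "i \<in> buses S" for t i
  proof (cases "i \<in> battery_buses S")
    case True
    have "u (t, i) \<in> {0, 1}"
      using u t i by (auto simp: binary_statuses_def)
    moreover have "0 \<le> Ecmin S" "0 \<le> Edmin S"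
      using assms(1) by (auto simp: valid_system_def)
    ultimately have "0 \<le> Ecmin S * u (t, i)" "0 \<le> Edmin S * (1 - u (t, i))"
      by auto
    moreover have "Ecmin S * u (t, i) \<le> pc p (t, i)" "Edmin S * (1 - u (t, i)) \<le> pd p (t, i)"
      using oc t True by (auto simp: operational_constraints_def)
    ultimately show ?thesis by linarith
  next
    case False
    then show ?thesis
      using oc t i by (auto simp: operational_constraints_def)
  qed
  then have "0 \<le> battery_usage S p $ 1" "0 \<le> battery_usage S p $ 2"
    by (auto simp: battery_usage_def intro!: sum_nonneg)
  then show ?thesis
    using exhaust_2[of k] by auto
qed

lemma optimal_value_le:
  assumes "(\<theta>, f, p, u) \<in> feasible_set S W"
  shows "optimal_value S W \<le> ereal (total_cost S p)"
  unfolding optimal_value_def using assms by (auto intro: INF_lower2)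

lemma optimal_value_antimono:
  assumes "V \<subseteq> W"
  shows "optimal_value S W \<le> optimal_value S V"
  unfolding optimal_value_def
  by (rule INF_superset_mono) (use assms in \<open>auto simp: feasible_set_def\<close>)

text \<open>An optimal point attains the infimum. In particular \<open>z_ori S\<close> is finite,
  which later allows passing from extended reals to reals.\<close>

lemma z_ori_eq:
  assumes "battery_optimal S (\<theta>, f, p, u)"
  shows "z_ori S = ereal (total_cost S p)"
proof (rule antisym)
  show "z_ori S \<le> ereal (total_cost S p)"
    using assms unfolding z_ori_def battery_optimal_def is_arg_min_def
    by (auto intro: optimal_value_le)
  show "ereal (total_cost S p) \<le> z_ori S"
    using assms unfolding z_ori_def optimal_value_def battery_optimal_def is_arg_min_def
    by (fastforce intro!: INF_greatest simp: not_less)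
qed

theorem proposition2:
  fixes S :: "'b battery_system" and l :: "real ^ 2"
  assumes "valid_system S"
    and "\<forall>k. 0 \<le> l $ k"
    and "0 < optimality_gap S"
    and "reg_battery_optimal S l (\<theta>h, fh, ph, uh)"
    and "\<exists>p\<in>optimal_powers S. ereal (l \<bullet> battery_usage S p) < optimality_gap S"
  shows "uh \<in> optimal_statuses S"
proof (rule ccontr)
  assume nopt: "uh \<notin> optimal_statuses S"
  obtain \<theta> f p u where opt: "battery_optimal S (\<theta>, f, p, u)"
    and small: "ereal (l \<bullet> battery_usage S p) < optimality_gap S"
    using assms(5) by (auto simp: optimal_powers_def)
  have feas: "(\<theta>h, fh, ph, uh) \<in> feasible_set S (binary_statuses S)"
    using assms(4) by (simp add: reg_battery_optimal_def is_arg_min_def)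
  \<comment> \<open>Both problems have the same feasible set, so the optimum of (Battery) competes
    in (Reg-Battery).\<close>
  have "total_cost S ph + l \<bullet> battery_usage S ph \<le> total_cost S p + l \<bullet> battery_usage S p"
    using opt assms(4)
    by (fastforce simp: battery_optimal_def reg_battery_optimal_def is_arg_min_def not_less)
  moreover have "0 \<le> l \<bullet> battery_usage S ph"
    using assms(2) battery_usage_nonneg[OF assms(1) feas] by (simp add: inner_vec_def sum_nonneg)
  ultimately have reg: "total_cost S ph \<le> total_cost S p + l \<bullet> battery_usage S p"
    by linarith
  have "(\<theta>h, fh, ph, uh) \<in> feasible_set S (binary_statuses S - optimal_statuses S)"
    using feas nopt by (auto simp: feasible_set_def)
  then have upper: "z_second S \<le> ereal (total_cost S ph)"
    unfolding z_second_def by (rule optimal_value_le)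
  have z_ori: "z_ori S = ereal (total_cost S p)"
    using opt by (rule z_ori_eq)
  \<comment> \<open>Needed twice: it removes the absolute value in \<open>optimality_gap\<close> and
    excludes the value -\<infinity> for \<open>z_second S\<close>.\<close>
  have lower: "z_ori S \<le> z_second S"
    unfolding z_ori_def z_second_def by (rule optimal_value_antimono) auto
  \<comment> \<open>The point with status \<open>uh\<close> bounds the second-best value from above,
    so it is not \<infinity> and the gap is an ordinary real difference.\<close>
  obtain r where "z_second S = ereal r"
    using upper lower z_ori by (cases "z_second S") auto
  then show False
    using upper lower z_ori small reg by (simp add: optimality_gap_def)
qed

end
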